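(* Let $\mathrm{D}^\alpha$, $\alpha\in(0,1]$, be a family of depth-trimmed regions satisfying D1–D5. For $X\in L_d^\infty$ put $\mathbb{D}^\alpha(X)=f(\mathrm{D}^\alpha(X)\oplus K)\subseteq\mathbb{C}$ and define $$s_\alpha(X)=\bigvee\{f(y):\ y\in\mathbb{R}^d,\ f(\mathrm{D}^\alpha(X-y)\oplus K)\subseteq\mathbb{A}\}.$$ Assume that $\mathbb{F}=\{f(y):y\in\mathbb{R}^d\}$ is sup-generating, i.e. $b=\bigvee\{a\in\mathbb{F}:a\preceq b\}$ for all $b\in\mathbb{C}$. Then, for every $\alpha\in(0,1]$, $$s_\alpha(X)=\bigwedge\mathbb{D}^\alpha(X),\qquad X\in L_d^\infty,$$ and $s_\alpha$ is a homogeneous risk measure associated with $f$. If the family of depth-trimmed regions satisfies D6, then $s_\alpha$ is a coherent risk measure such that $s_\alpha(X)\succeq s_\beta(X)$ for $\alpha\geq\beta$.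
   Context: $L_d^\infty$ is the set of essentially bounded $d$-dimensional random vectors on a probability space; $\mathbb{R}^d$ is embedded in it as the constants. Convex cone: $\mathbb{C}$ is a topological space with a commutative, associative, continuous operation $\oplus$ with neutral element $\mathbf{e}$, and a continuous multiplication $(x,t)\mapsto t\odot x$ by scalars $t>0$ with $1\odot x=x$, $t\odot\mathbf{e}=\mathbf{e}$, $t\odot(x\oplus y)=t\odot x\oplus t\odot y$, $t\odot(s\odot x)=(ts)\odot x$. $\mathbb{C}$ carries a partial order $\preceq$ such that $x\preceq y$ implies $x\oplus z\preceq y\oplus z$ for all $z$ and $t\odot x\preceq t\odot y$ for all $t>0$; with it $\mathbb{C}$ is a complete lattice (supremum $\bigvee$, infimum $\bigwedge$) whose top element $\mathbb{T}$ is absorbing ($\mathbb{T}\oplus a=\mathbb{T}$ for all $a$). $K\subsetneq\mathbb{R}^d$ is a closed proper Euclidean convex cone: $\mathbb{R}^d_+\subseteq K$, $K$ contains no line, and $x+y\in K$, $tx\in K$ for $x,y\in K$, $t>0$. Write $x\leq_K y$ iff $y-x\in K$. $f:\mathbb{R}^d\to\mathbb{C}$ satisfies $f(0)=\mathbf{e}$, $f(x)\oplus f(y)=f(x+y)$, $f(tx)=t\odot f(x)$ for $t>0$, and $f(y)\preceq f(x)$ whenever $y\leq_K x$. The acceptance cone is $\mathbb{A}=\{a\in\mathbb{C}:\mathbf{e}\preceq a\}$, and it is assumed that $f(x)\in\mathbb{A}$ if and only if $0\leq_K x$. A functional $\varrho:L_d^\infty\to\mathbb{C}$ is a risk measure associated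 with $f$ if $\varrho(X)=f(x)$ whenever $X=x$ a.s., and (R1) $f(y)\oplus\varrho(X)=\varrho(X+y)$ for all $y\in\mathbb{R}^d$; (R2) $\varrho(Y)\preceq\varrho(X)$ whenever $Y\leq_K X$ a.s. It is homogeneous if also (R3) $\varrho(tX)=t\odot\varrho(X)$ for all $t>0$, and coherent if it is homogeneous and (R4) $\varrho(X)\oplus\varrho(Y)\preceq\varrho(X+Y)$ for all $X,Y$. For subsets of $\mathbb{R}^d$, $A\oplus B$ denotes the closed Minkowski sum, i.e. the closure of $\{x+y:x\in A,y\in B\}$. For $S\subseteq\mathbb{R}^d$, $f(S)=\{f(x):x\in S\}$. A family of depth-trimmed regions assigns to each $X\in L_d^\infty$ and $\alpha\in(0,1]$ a set $\mathrm{D}^\alpha(X)\subseteq\mathbb{R}^d$. The properties are, for all $\alpha,\beta$ and all $X,Y\in L_d^\infty$: D1: $\mathrm{D}^\alpha(X+y)=\mathrm{D}^\alpha(X)+y$ for all $y\in\mathbb{R}^d$; D2: $\mathrm{D}^\alpha(tX)=t\,\mathrm{D}^\alpha(X)$ for all $t>0$; D3: $\mathrm{D}^\alpha(X)\subseteq\mathrm{D}^\beta(X)$ if $\alpha\geq\beta$; D4: $\mathrm{D}^\alpha(X)$ is connected and closed; D5: if $Y\leq_K X$ a.s., then $\mathrm{D}^\alpha(X)\subseteq\mathrm{D}^\alpha(Y)\oplus K$; and $0\in\mathrm{D}^\alpha(X)\subseteq K$ if $X=0$ a.s.; D6: $\mathrm{D}^\alpha(X+Y)\subseteq\mathrm{D}^\alpha(X)\oplus\mathrm{D}^\alpha(Y)$.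 *)

theory Defs
  imports "HOL-Probability.Probability"
begin

text \<open>
  The convex cone \<open>\<C>\<close> is a type \<open>'c\<close>. Its operation \<open>\<oplus>\<close>, neutral element \<open>\<e>\<close>
  and order are \<open>+\<close>, \<open>0\<close> and \<open>\<le>\<close>; the sort makes \<open>+\<close> commutative, associative, jointly
  continuous and monotone, and the order a complete lattice. It imposes no relation between order and
  topology, and no separation axiom. Only multiplication by scalars \<open>t > 0\<close> is constrained.
\<close>

locale lattice_convex_cone =
  fixes smult :: "real \<Rightarrow> 'c :: {topological_comm_monoid_add, ordered_comm_monoid_add, complete_lattice} \<Rightarrow> 'c"
    (infixr "\<odot>" 75)
  assumes smult_continuous: "continuous_on (UNIV \<times> {0<..}) (\<lambda>(x, t). t \<odot> x)"
    and smult_one: "1 \<odot> x = x"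
    and smult_neutral: "t > 0 \<Longrightarrow> t \<odot> 0 = 0"
    and smult_add: "t > 0 \<Longrightarrow> t \<odot> (x + y) = t \<odot> x + t \<odot> y"
    and smult_smult: "t > 0 \<Longrightarrow> s > 0 \<Longrightarrow> t \<odot> (s \<odot> x) = (t * s) \<odot> x"
    and smult_mono: "t > 0 \<Longrightarrow> x \<le> y \<Longrightarrow> t \<odot> x \<le> t \<odot> y"
    and top_absorbing: "top + x = top"

definition acceptance_cone :: "'c::{zero, order} set" where
  "acceptance_cone = {a. 0 \<le> a}"

definition sup_generating :: "'c::complete_lattice set \<Rightarrow> bool" where
  "sup_generating F \<longleftrightarrow> (\<forall>b. b = Sup {a \<in> F. a \<le> b})"

definition contains_line :: "'v::real_vector set \<Rightarrow> bool" where
  "contains_line S \<longleftrightarrow> (\<exists>x v. v \<noteq> 0 \<and> (\<forall>t. x + t *\<^sub>R v \<in> S))"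

locale proper_euclidean_cone =
  fixes K :: "(real ^ 'd) set"
  assumes closed: "closed K"
    and proper: "K \<noteq> UNIV"
    and orthant: "{x. \<forall>i. 0 \<le> x $ i} \<subseteq> K"
    and no_line: "\<not> contains_line K"
    and add_mem: "x \<in> K \<Longrightarrow> y \<in> K \<Longrightarrow> x + y \<in> K"
    and scale_mem: "t > 0 \<Longrightarrow> x \<in> K \<Longrightarrow> t *\<^sub>R x \<in> K"

definition cone_le :: "(real ^ 'd) set \<Rightarrow> real ^ 'd \<Rightarrow> real ^ 'd \<Rightarrow> bool" where
  "cone_le K x y \<longleftrightarrow> y - x \<in> K"

locale monotone_cone_map =
  fixes smult :: "real \<Rightarrow> 'c :: {comm_monoid_add, order} \<Rightarrow> 'c"
    and K :: "(real ^ 'd) set"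
    and f :: "real ^ 'd \<Rightarrow> 'c"
  assumes map_zero: "f 0 = 0"
    and map_add: "f x + f y = f (x + y)"
    and map_scale: "t > 0 \<Longrightarrow> f (t *\<^sub>R x) = smult t (f x)"
    and map_mono: "cone_le K y x \<Longrightarrow> f y \<le> f x"

text \<open>
  Random vectors are measurable functions rather than almost sure equivalence classes. Functionals
  and set-valued maps below are total functions of which only the values on \<open>Linfty M\<close> matter;
  they are not required to respect almost sure equality beyond what their axioms imply.
\<close>

definition Linfty :: "'a measure \<Rightarrow> ('a \<Rightarrow> real ^ 'd) set" where
  "Linfty M = {X \<in> borel_measurable M. \<exists>c. AE \<omega> in M. norm (X \<omega>) \<le> c}"

locale risk_measure =
  fixes M :: "'a measure"
    and K :: "(real ^ 'd) set"
    and f :: "real ^ 'd \<Rightarrow> 'c :: {comm_monoid_add, order}"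
    and \<rho> :: "('a \<Rightarrow> real ^ 'd) \<Rightarrow> 'c"
  assumes associated: "X \<in> Linfty M \<Longrightarrow> AE \<omega> in M. X \<omega> = x \<Longrightarrow> \<rho> X = f x"
    and R1: "X \<in> Linfty M \<Longrightarrow> f y + \<rho> X = \<rho> (\<lambda>\<omega>. X \<omega> + y)"
    and R2: "X \<in> Linfty M \<Longrightarrow> Y \<in> Linfty M \<Longrightarrow> AE \<omega> in M. cone_le K (Y \<omega>) (X \<omega>) \<Longrightarrow> \<rho> Y \<le> \<rho> X"

locale homogeneous_risk_measure = risk_measure M K f \<rho>
  for smult :: "real \<Rightarrow> 'c :: {comm_monoid_add, order} \<Rightarrow> 'c"
    and M :: "'a measure"
    and K :: "(real ^ 'd) set"
    and f :: "real ^ 'd \<Rightarrow> 'c"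
    and \<rho> :: "('a \<Rightarrow> real ^ 'd) \<Rightarrow> 'c" +
  assumes R3: "X \<in> Linfty M \<Longrightarrow> t > 0 \<Longrightarrow> \<rho> (\<lambda>\<omega>. t *\<^sub>R X \<omega>) = smult t (\<rho> X)"

locale coherent_risk_measure = homogeneous_risk_measure smult M K f \<rho>
  for smult :: "real \<Rightarrow> 'c :: {comm_monoid_add, order} \<Rightarrow> 'c"
    and M :: "'a measure"
    and K :: "(real ^ 'd) set"
    and f :: "real ^ 'd \<Rightarrow> 'c"
    and \<rho> :: "('a \<Rightarrow> real ^ 'd) \<Rightarrow> 'c" +
  assumes R4: "X \<in> Linfty M \<Longrightarrow> Y \<in> Linfty M \<Longrightarrow> \<rho> X + \<rho> Y \<le> \<rho> (\<lambda>\<omega>. X \<omega> + Y \<omega>)"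

definition minkowski :: "(real ^ 'd) set \<Rightarrow> (real ^ 'd) set \<Rightarrow> (real ^ 'd) set" where
  "minkowski A B = closure {x + y |x y. x \<in> A \<and> y \<in> B}"

locale depth_trimmed_regions =
  fixes M :: "'a measure"
    and K :: "(real ^ 'd) set"
    and D :: "real \<Rightarrow> ('a \<Rightarrow> real ^ 'd) \<Rightarrow> (real ^ 'd) set"
  assumes D1: "\<alpha> \<in> {0<..1} \<Longrightarrow> X \<in> Linfty M \<Longrightarrow> D \<alpha> (\<lambda>\<omega>. X \<omega> + y) = (\<lambda>x. x + y) ` D \<alpha> X"
    and D2: "\<alpha> \<in> {0<..1} \<Longrightarrow> X \<in> Linfty M \<Longrightarrow> t > 0 \<Longrightarrow>
      D \<alpha> (\<lambda>\<omega>. t *\<^sub>R X \<omega>) = (\<lambda>x. t *\<^sub>R x) ` D \<alpha> X"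
    and D3: "\<alpha> \<in> {0<..1} \<Longrightarrow> \<beta> \<in> {0<..1} \<Longrightarrow> X \<in> Linfty M \<Longrightarrow> \<alpha> \<ge> \<beta> \<Longrightarrow> D \<alpha> X \<subseteq> D \<beta> X"
    and D4: "\<alpha> \<in> {0<..1} \<Longrightarrow> X \<in> Linfty M \<Longrightarrow> connected (D \<alpha> X) \<and> closed (D \<alpha> X)"
    and D5_mono: "\<alpha> \<in> {0<..1} \<Longrightarrow> X \<in> Linfty M \<Longrightarrow> Y \<in> Linfty M \<Longrightarrow>
      AE \<omega> in M. cone_le K (Y \<omega>) (X \<omega>) \<Longrightarrow> D \<alpha> X \<subseteq> minkowski (D \<alpha> Y) K"
    and D5_zero: "\<alpha> \<in> {0<..1} \<Longrightarrow> X \<in> Linfty M \<Longrightarrow> AE \<omega> in M. X \<omega> = 0 \<Longrightarrow> 0 \<in> D \<alpha> X \<and> D \<alpha> X \<subseteq> K"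

definition depth_subadditive ::
    "'a measure \<Rightarrow> (real \<Rightarrow> ('a \<Rightarrow> real ^ 'd) \<Rightarrow> (real ^ 'd) set) \<Rightarrow> bool" where \<comment> \<open>property D6\<close>
  "depth_subadditive M D \<longleftrightarrow> (\<forall>\<alpha>\<in>{0<..1}. \<forall>X\<in>Linfty M. \<forall>Y\<in>Linfty M.
     D \<alpha> (\<lambda>\<omega>. X \<omega> + Y \<omega>) \<subseteq> minkowski (D \<alpha> X) (D \<alpha> Y))"

definition depth_image ::
    "(real ^ 'd) set \<Rightarrow> (real ^ 'd \<Rightarrow> 'c) \<Rightarrow> (real \<Rightarrow> ('a \<Rightarrow> real ^ 'd) \<Rightarrow> (real ^ 'd) set)
      \<Rightarrow> real \<Rightarrow> ('a \<Rightarrow> real ^ 'd) \<Rightarrow> 'c set" where \<comment> \<open>\<open>\<D>\<^sup>\<alpha>(X)\<close>\<close>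
  "depth_image K f D \<alpha> X = f ` minkowski (D \<alpha> X) K"

definition depth_risk ::
    "(real ^ 'd) set \<Rightarrow> (real ^ 'd \<Rightarrow> 'c :: {zero, complete_lattice})
      \<Rightarrow> (real \<Rightarrow> ('a \<Rightarrow> real ^ 'd) \<Rightarrow> (real ^ 'd) set)
      \<Rightarrow> real \<Rightarrow> ('a \<Rightarrow> real ^ 'd) \<Rightarrow> 'c" where \<comment> \<open>\<open>s\<^sub>\<alpha>(X)\<close>\<close>
  "depth_risk K f D \<alpha> X = Sup {f y |y. depth_image K f D \<alpha> (\<lambda>\<omega>. X \<omega> - y) \<subseteq> acceptance_cone}"

end

theory Submission
  imports Defs
begin

text \<open>
  Since \<open>f (-y)\<close> is inverse to \<open>f y\<close>, the acceptance condition makes \<open>f\<close> an order embedding: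
  \<open>f y \<le> f x\<close> iff \<open>y \<le>\<^sub>K x\<close>. Hence the constraint in the definition of \<open>s\<^sub>\<alpha>(X)\<close> says that \<open>f y\<close>
  is a lower bound of \<open>\<D>\<^sup>\<alpha>(X)\<close>, and sup-generation identifies the supremum of such values with the infimum.
  Although \<open>f\<close> need not be continuous, sup-generation also turns each set \<open>{z. b \<le> f z}\<close> into
  an intersection of translates of \<open>K\<close>, so it is closed. Consequently neither closures nor the
  summand \<open>K\<close> affect lower bounds, \<open>s\<^sub>\<alpha>(X)\<close> is the infimum of \<open>f\<close> over \<open>D\<^sup>\<alpha>(X)\<close> itself,
  and the axioms of risk measures follow from the corresponding properties of the regions.
\<close>

section \<open>Closure properties of bounded random vectors\<close>

lemma Linfty_const: "(\<lambda>\<omega>. y) \<in> Linfty M"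
  by (auto simp: Linfty_def)

lemma Linfty_add:
  assumes "X \<in> Linfty M" "Y \<in> Linfty M"
  shows "(\<lambda>\<omega>. X \<omega> + Y \<omega>) \<in> Linfty M"
proof -
  obtain c d where "AE \<omega> in M. norm (X \<omega>) \<le> c" "AE \<omega> in M. norm (Y \<omega>) \<le> d"
    using assms by (auto simp: Linfty_def)
  then have "AE \<omega> in M. norm (X \<omega> + Y \<omega>) \<le> c + d"
    by eventually_elim (rule norm_triangle_mono)
  then show ?thesis
    using assms by (auto simp: Linfty_def)
qed

lemma Linfty_scaleR:
  assumes "X \<in> Linfty M"
  shows "(\<lambda>\<omega>. t *\<^sub>R X \<omega>) \<in> Linfty M"
proof -
  obtain c where "AE \<omega> in M. norm (X \<omega>) \<le> c"
    using assms by (auto simp: Linfty_def)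
  then have "AE \<omega> in M. norm (t *\<^sub>R X \<omega>) \<le> \<bar>t\<bar> * c"
    by eventually_elim (simp add: mult_left_mono)
  then show ?thesis
    using assms by (auto simp: Linfty_def)
qed

section \<open>Order and infima of values of \<open>f\<close>\<close>

locale sup_generating_cone_map =
  lattice_convex_cone smult + proper_euclidean_cone K + monotone_cone_map smult K f
  for smult :: "real \<Rightarrow> 'c :: {topological_comm_monoid_add, ordered_comm_monoid_add, complete_lattice} \<Rightarrow> 'c"
    and K :: "(real ^ 'd) set"
    and f :: "real ^ 'd \<Rightarrow> 'c" +
  assumes map_acceptance: "f x \<in> acceptance_cone \<longleftrightarrow> cone_le K 0 x"
    and sup_generating_range: "sup_generating (range f)"
begin

lemma zero_mem: "0 \<in> K"
  using orthant by auto

lemma map_nonneg_iff: "0 \<le> f x \<longleftrightarrow> x \<in> K"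
  using map_acceptance[of x] by (simp add: acceptance_cone_def cone_le_def)

lemma map_le_iff: "f y \<le> f x \<longleftrightarrow> x - y \<in> K"
proof
  assume "f y \<le> f x"
  then have "f y + f (- y) \<le> f x + f (- y)"
    by (rule add_right_mono)
  then show "x - y \<in> K"
    by (simp add: map_add map_zero map_nonneg_iff)
next
  assume "x - y \<in> K"
  then show "f y \<le> f x"
    by (intro map_mono) (simp add: cone_le_def)
qed

lemma Sup_below: "Sup {f y |y. f y \<le> b} = b"
proof -
  have "{a \<in> range f. a \<le> b} = {f y |y. f y \<le> b}"
    by auto
  then show ?thesis
    using sup_generating_range by (metis sup_generating_def)
qed

text \<open>As \<open>b\<close> is the supremum of the values of \<open>f\<close> below it, only
  values of \<open>f\<close> need comparing, and \<open>K\<close> decides those.\<close>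

lemma le_map_iff: "b \<le> f z \<longleftrightarrow> (\<forall>u. f u \<le> b \<longrightarrow> z - u \<in> K)"
proof -
  have "b \<le> f z \<longleftrightarrow> Sup {f u |u. f u \<le> b} \<le> f z"
    by (simp only: Sup_below)
  also have "\<dots> \<longleftrightarrow> (\<forall>u. f u \<le> b \<longrightarrow> f u \<le> f z)"
    by (auto simp: Sup_le_iff)
  finally show ?thesis
    by (simp only: map_le_iff)
qed

lemma closed_le_map: "closed {z. b \<le> f z}"
proof -
  have "{z. b \<le> f z} = (\<Inter>u\<in>{u. f u \<le> b}. (\<lambda>z. z - u) -` K)"
    by (auto simp: le_map_iff)
  also have "closed \<dots>"
    by (intro closed_INT ballI closed_vimage closed continuous_intros)
  finally show ?thesis .
qed

lemma le_map_minkowski_iff: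
  "(\<forall>z\<in>minkowski A B. b \<le> f z) \<longleftrightarrow> (\<forall>x\<in>A. \<forall>y\<in>B. b \<le> f x + f y)"
proof -
  have "closure {x + y |x y. x \<in> A \<and> y \<in> B} \<subseteq> {z. b \<le> f z}
      \<longleftrightarrow> {x + y |x y. x \<in> A \<and> y \<in> B} \<subseteq> {z. b \<le> f z}"
    \<comment> \<open>Closedness gives the implication from right to left, hence the rotated
      rule.\<close>
    using closure_minimal[OF _ closed_le_map] order_trans[OF closure_subset] by (rule iffI[rotated])
  then show ?thesis
    unfolding minkowski_def subset_eq mem_Collect_eq map_add by blast
qed

text \<open>Adding a point of \<open>K\<close> can only raise the value of \<open>f\<close>, and the
  point 0 of \<open>K\<close> leaves it unchanged.\<close>

lemma Inf_map_minkowski_cone: "Inf (f ` minkowski A K) = Inf (f ` A)"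
proof (rule antisym)
  have "Inf (f ` minkowski A K) \<le> f x + f y" if "x \<in> A" "y \<in> K" for x y
    using le_map_minkowski_iff[of A K "Inf (f ` minkowski A K)"] that by (auto intro: INF_lower)
  from this[OF _ zero_mem] show "Inf (f ` minkowski A K) \<le> Inf (f ` A)"
    by (auto intro!: INF_greatest simp: map_zero)
next
  have "Inf (f ` A) \<le> f x + f y" if "x \<in> A" "y \<in> K" for x y
    using add_mono[of "Inf (f ` A)" "f x" 0 "f y"] that by (auto simp: map_nonneg_iff INF_lower)
  then show "Inf (f ` A) \<le> Inf (f ` minkowski A K)"
    by (intro INF_greatest) (use le_map_minkowski_iff in blast)
qed

text \<open>Addition of \<open>f y\<close> is an order automorphism with inverse addition of
  \<open>f (- y)\<close>, so it preserves infima, also for empty \<open>A\<close>.\<close>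

lemma map_add_Inf: "f y + Inf (f ` A) = Inf (f ` (\<lambda>x. x + y) ` A)"
proof (rule antisym)
  have "f y + Inf (f ` A) \<le> f (x + y)" if "x \<in> A" for x
    using add_left_mono[OF INF_lower[OF that, of f], of "f y"] by (simp add: map_add add.commute)
  then show "f y + Inf (f ` A) \<le> Inf (f ` (\<lambda>x. x + y) ` A)"
    by (auto intro: INF_greatest)
next
  let ?I = "Inf (f ` (\<lambda>x. x + y) ` A)"
  have "f (- y) + ?I \<le> f (- y) + f (x + y)" if "x \<in> A" for x
    using that by (intro add_left_mono INF_lower) auto
  then have "f (- y) + ?I \<le> Inf (f ` A)"
    by (auto intro!: INF_greatest simp: map_add)
  then have "f y + (f (- y) + ?I) \<le> f y + Inf (f ` A)"
    by (rule add_left_mono)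
  then show "?I \<le> f y + Inf (f ` A)"
    by (simp add: add.assoc[symmetric] map_add map_zero)
qed

text \<open>Multiplication by \<open>t\<close> is an order automorphism, inverted by multiplication
  by \<open>inverse t\<close>.\<close>

lemma Inf_map_scaleR:
  assumes "t > 0"
  shows "Inf (f ` (\<lambda>x. t *\<^sub>R x) ` A) = smult t (Inf (f ` A))"
proof (rule antisym)
  show "smult t (Inf (f ` A)) \<le> Inf (f ` (\<lambda>x. t *\<^sub>R x) ` A)"
    using assms by (auto intro!: INF_greatest smult_mono INF_lower simp: map_scale)
next
  let ?I = "Inf (f ` (\<lambda>x. t *\<^sub>R x) ` A)"
  have "smult (inverse t) ?I \<le> f x" if "x \<in> A" for x
  proof -
    have "smult (inverse t) ?I \<le> smult (inverse t) (f (t *\<^sub>R x))"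
      using assms that by (intro smult_mono INF_lower) auto
    also have "\<dots> = f x"
      using assms map_scale[of "inverse t" "t *\<^sub>R x"] by simp
    finally show ?thesis .
  qed
  then have "smult t (smult (inverse t) ?I) \<le> smult t (Inf (f ` A))"
    using assms by (intro smult_mono INF_greatest) auto
  then show "?I \<le> smult t (Inf (f ` A))"
    using assms by (simp add: smult_smult smult_one)
qed

text \<open>The source of R4: the sum of the infima bounds every \<open>f x + f y\<close>, and lower
  bounds survive the closure.\<close>

lemma Inf_map_add_le_minkowski:
  "Inf (f ` A) + Inf (f ` B) \<le> Inf (f ` minkowski A B)"
proof -
  have "\<forall>x\<in>A. \<forall>y\<in>B. Inf (f ` A) + Inf (f ` B) \<le> f x + f y"
    by (auto intro: add_mono INF_lower)
  then show ?thesis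
    by (intro INF_greatest) (use le_map_minkowski_iff in blast)
qed

end

section \<open>Risk measures from depth-trimmed regions\<close>

locale depth_risk_setting =
  sup_generating_cone_map smult K f + depth_trimmed_regions M K D
  for smult :: "real \<Rightarrow> 'c :: {topological_comm_monoid_add, ordered_comm_monoid_add, complete_lattice} \<Rightarrow> 'c"
    and K :: "(real ^ 'd) set"
    and f :: "real ^ 'd \<Rightarrow> 'c"
    and M :: "'a measure"
    and D :: "real \<Rightarrow> ('a \<Rightarrow> real ^ 'd) \<Rightarrow> (real ^ 'd) set"
begin

lemma Inf_depth_image: "Inf (depth_image K f D \<alpha> X) = Inf (f ` D \<alpha> X)"
  by (simp add: depth_image_def Inf_map_minkowski_cone)

lemma region_diff:
  assumes "\<alpha> \<in> {0<..1}" "X \<in> Linfty M"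
  shows "D \<alpha> (\<lambda>\<omega>. X \<omega> - y) = (\<lambda>x. x - y) ` D \<alpha> X"
  using D1[OF assms, of "- y"] by simp

text \<open>Acceptability means that 0 is a lower bound; undoing the shift by \<open>y\<close> turns
  the bound 0 into \<open>f y\<close>.\<close>

lemma depth_image_diff_acceptable_iff:
  assumes "\<alpha> \<in> {0<..1}" "X \<in> Linfty M"
  shows "depth_image K f D \<alpha> (\<lambda>\<omega>. X \<omega> - y) \<subseteq> acceptance_cone \<longleftrightarrow> f y \<le> Inf (f ` D \<alpha> X)"
proof -
  have "depth_image K f D \<alpha> (\<lambda>\<omega>. X \<omega> - y) \<subseteq> acceptance_cone
      \<longleftrightarrow> 0 \<le> Inf (depth_image K f D \<alpha> (\<lambda>\<omega>. X \<omega> - y))"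
    by (auto simp: acceptance_cone_def le_Inf_iff)
  also have "\<dots> \<longleftrightarrow> 0 \<le> Inf (f ` (\<lambda>x. x - y) ` D \<alpha> X)"
    by (simp only: Inf_depth_image region_diff[OF assms])
  also have "\<dots> \<longleftrightarrow> f y \<le> Inf (f ` D \<alpha> X)"
    by (simp add: le_INF_iff map_nonneg_iff map_le_iff)
  finally show ?thesis .
qed

lemma depth_risk_eq_Inf:
  assumes "\<alpha> \<in> {0<..1}" "X \<in> Linfty M"
  shows "depth_risk K f D \<alpha> X = Inf (f ` D \<alpha> X)"
  by (simp add: depth_risk_def depth_image_diff_acceptable_iff[OF assms] Sup_below)

lemma depth_risk_associated:
  assumes "\<alpha> \<in> {0<..1}" "X \<in> Linfty M" "AE \<omega> in M. X \<omega> = x"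
  shows "depth_risk K f D \<alpha> X = f x"
proof -
  have "(\<lambda>\<omega>. X \<omega> - x) \<in> Linfty M"
    using Linfty_add[OF assms(2) Linfty_const[of "- x"]] by simp
  moreover have "AE \<omega> in M. X \<omega> - x = 0"
    using assms(3) by simp
  \<comment> \<open>Thus \<open>x\<close> is the least point of \<open>D \<alpha> X\<close> in the
    order of \<open>K\<close>, and the infimum is attained there.\<close>
  ultimately have "0 \<in> (\<lambda>z. z - x) ` D \<alpha> X" "(\<lambda>z. z - x) ` D \<alpha> X \<subseteq> K"
    using D5_zero[OF assms(1)] by (simp_all add: region_diff[OF assms(1,2), symmetric])
  then have "Inf (f ` D \<alpha> X) = f x"
    by (intro antisym INF_lower INF_greatest) (auto simp: map_le_iff)
  then show ?thesis
    by (simp add: depth_risk_eq_Inf[OF assms(1,2)])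
qed

text \<open>A larger set has a smaller infimum, and the summand \<open>K\<close> in
  \<open>D5_mono\<close> does not change the infimum.\<close>

lemma depth_risk_mono:
  assumes "\<alpha> \<in> {0<..1}" "X \<in> Linfty M" "Y \<in> Linfty M" "AE \<omega> in M. cone_le K (Y \<omega>) (X \<omega>)"
  shows "depth_risk K f D \<alpha> Y \<le> depth_risk K f D \<alpha> X"
proof -
  have "Inf (f ` minkowski (D \<alpha> Y) K) \<le> Inf (f ` D \<alpha> X)"
    by (intro Inf_superset_mono image_mono D5_mono assms)
  then show ?thesis
    by (simp only: Inf_map_minkowski_cone depth_risk_eq_Inf[OF assms(1,2)]
        depth_risk_eq_Inf[OF assms(1,3)])
qed

lemma homogeneous_risk_measure_depth_risk:
  assumes "\<alpha> \<in> {0<..1}"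
  shows "homogeneous_risk_measure smult M K f (depth_risk K f D \<alpha>)"
proof
  fix X :: "'a \<Rightarrow> real ^ 'd" and y assume "X \<in> Linfty M"
  then show "f y + depth_risk K f D \<alpha> X = depth_risk K f D \<alpha> (\<lambda>\<omega>. X \<omega> + y)"
    using assms by (simp add: depth_risk_eq_Inf Linfty_add Linfty_const D1 map_add_Inf)
next
  fix X :: "'a \<Rightarrow> real ^ 'd" and t :: real assume "X \<in> Linfty M" "t > 0"
  then show "depth_risk K f D \<alpha> (\<lambda>\<omega>. t *\<^sub>R X \<omega>) = smult t (depth_risk K f D \<alpha> X)"
    using assms by (simp add: depth_risk_eq_Inf Linfty_scaleR D2 Inf_map_scaleR)
qed (fact depth_risk_associated[OF assms] depth_risk_mono[OF assms])+

lemma coherent_risk_measure_depth_risk: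
  assumes "\<alpha> \<in> {0<..1}" "depth_subadditive M D"
  shows "coherent_risk_measure smult M K f (depth_risk K f D \<alpha>)"
proof -
  interpret homogeneous_risk_measure smult M K f "depth_risk K f D \<alpha>"
    by (rule homogeneous_risk_measure_depth_risk) (rule assms)
  show ?thesis
  proof
    fix X Y :: "'a \<Rightarrow> real ^ 'd" assume XY: "X \<in> Linfty M" "Y \<in> Linfty M"
    have "Inf (f ` minkowski (D \<alpha> X) (D \<alpha> Y)) \<le> Inf (f ` D \<alpha> (\<lambda>\<omega>. X \<omega> + Y \<omega>))"
      using assms XY by (intro Inf_superset_mono image_mono) (simp add: depth_subadditive_def)
    with Inf_map_add_le_minkowski
    have "Inf (f ` D \<alpha> X) + Inf (f ` D \<alpha> Y) \<le> Inf (f ` D \<alpha> (\<lambda>\<omega>. X \<omega> + Y \<omega>))"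
      by (rule order_trans)
    then show "depth_risk K f D \<alpha> X + depth_risk K f D \<alpha> Y \<le> depth_risk K f D \<alpha> (\<lambda>\<omega>. X \<omega> + Y \<omega>)"
      using assms XY by (simp add: depth_risk_eq_Inf Linfty_add)
  qed
qed

text \<open>By \<open>D3\<close> a higher level has a smaller region, hence a larger
  infimum.\<close>

lemma depth_risk_mono_level:
  assumes "\<alpha> \<in> {0<..1}" "\<beta> \<in> {0<..1}" "\<beta> \<le> \<alpha>" "X \<in> Linfty M"
  shows "depth_risk K f D \<beta> X \<le> depth_risk K f D \<alpha> X"
  unfolding depth_risk_eq_Inf[OF assms(1,4)] depth_risk_eq_Inf[OF assms(2,4)]
  by (intro Inf_superset_mono image_mono D3 assms)

end

theorem theorem6p5:
  fixes M :: "'a measure"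
    and smult :: "real \<Rightarrow> 'c :: {topological_comm_monoid_add, ordered_comm_monoid_add, complete_lattice} \<Rightarrow> 'c"
    and K :: "(real ^ 'd) set"
    and f :: "real ^ 'd \<Rightarrow> 'c"
    and D :: "real \<Rightarrow> ('a \<Rightarrow> real ^ 'd) \<Rightarrow> (real ^ 'd) set"
  assumes "prob_space M"
    and "lattice_convex_cone smult"
    and "proper_euclidean_cone K"
    and "monotone_cone_map smult K f"
    and "\<And>x. f x \<in> acceptance_cone \<longleftrightarrow> cone_le K 0 x"
    and "depth_trimmed_regions M K D"
    and "sup_generating (range f)"
  shows "(\<forall>\<alpha>\<in>{0<..1}.
            (\<forall>X\<in>Linfty M. depth_risk K f D \<alpha> X = Inf (depth_image K f D \<alpha> X)) \<and>
            homogeneous_risk_measure smult M K f (depth_risk K f D \<alpha>)) \<and>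
         (depth_subadditive M D \<longrightarrow>
            (\<forall>\<alpha>\<in>{0<..1}. coherent_risk_measure smult M K f (depth_risk K f D \<alpha>)) \<and>
            (\<forall>\<alpha>\<in>{0<..1}. \<forall>\<beta>\<in>{0<..1}. \<alpha> \<ge> \<beta> \<longrightarrow>
               (\<forall>X\<in>Linfty M. depth_risk K f D \<alpha> X \<ge> depth_risk K f D \<beta> X)))"
proof -
  interpret depth_risk_setting smult K f M D
    using assms(2-7)
    by (intro depth_risk_setting.intro sup_generating_cone_map.intro
        sup_generating_cone_map_axioms.intro)
  show ?thesis
    \<comment> \<open>Folding replaces the infimum over \<open>D \<alpha> X\<close> by the one over
      \<open>depth_image\<close> that the theorem states.\<close>
    by (intro conjI ballI impI depth_risk_eq_Inf[folded Inf_depth_image]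
        homogeneous_risk_measure_depth_risk coherent_risk_measure_depth_risk depth_risk_mono_level)
qed

end
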